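(* A domain $R$ has the property that every nonzero ideal is $w$-basic if and only if $R$ is a P$v$MD of $t$-dimension $1$ (i.e., every maximal $t$-ideal of $R$ has height one).
   Context: For a domain $R$ with quotient field $K$ and nonzero fractional ideal $I$: $I^{-1}=(R:I)=\{x\in K:xI\subseteq R\}$, $I_v=(I^{-1})^{-1}$, $I_t=\bigcup J_v$ over finitely generated subideals $J\subseteq I$; a maximal $t$-ideal is an ideal maximal among proper integral ideals $Q$ with $Q_t=Q$. The $w$-operation is $I_w=\bigcup(I:J)$ over finitely generated ideals $J$ with $J_v=R$ (equivalently $I_w=\bigcap_M IR_M$ over maximal $t$-ideals $M$). $R$ is a P$v$MD if every nonzero finitely generated ideal $I$ satisfies $(II^{-1})_t=R$ (equivalently $R_M$ is a valuation domain for each maximal $t$-ideal $M$). For a nonzero ideal $I$, an ideal $J\subseteq I$ is a $w$-reduction of $I$ if $(JI^n)_w=(I^{n+1})_w$ for some integer $n\ge0$; $I$ is $w$-basic if every $w$-reduction $J$ of $I$ satisfies $J_w=I_w$. *)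

theory Defs
  imports "HOL-Computational_Algebra.Fraction_Field"
begin

text \<open>Setting: a domain R is a type of class idom; its quotient field K is the
  type 'a fract, with canonical embedding emb.  Fractional ideals / submodules
  are subsets of K; integral ideals of R are subsets of R (type 'a).\<close>

definition emb :: "'a::idom \<Rightarrow> 'a fract" where
  "emb a = Fract a 1"

definition Rf :: "'a::idom fract set" where
  "Rf = range emb"

definition is_ideal :: "'a::idom set \<Rightarrow> bool" where
  "is_ideal I \<longleftrightarrow> 0 \<in> I \<and> (\<forall>x\<in>I. \<forall>y\<in>I. x + y \<in> I) \<and> (\<forall>r x. x \<in> I \<longrightarrow> r * x \<in> I)"

definition fI :: "'a::idom set \<Rightarrow> 'a fract set" where
  "fI I = emb ` I"

definition rspan :: "'a::idom fract set \<Rightarrow> 'a fract set" where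
  "rspan S = {x. \<exists>F c. finite F \<and> F \<subseteq> S \<and> x = (\<Sum>s\<in>F. emb (c s) * s)}"

definition fin_gen :: "'a::idom fract set \<Rightarrow> bool" where
  "fin_gen M \<longleftrightarrow> (\<exists>F. finite F \<and> M = rspan F)"

definition mod_prod :: "'a::idom fract set \<Rightarrow> 'a fract set \<Rightarrow> 'a fract set" where
  "mod_prod A B = rspan {a * b |a b. a \<in> A \<and> b \<in> B}"

definition ideal_prod :: "'a::idom set \<Rightarrow> 'a set \<Rightarrow> 'a set" where
  "ideal_prod I J = \<Inter>{L. is_ideal L \<and> {a * b |a b. a \<in> I \<and> b \<in> J} \<subseteq> L}"

primrec ideal_pow :: "'a::idom set \<Rightarrow> nat \<Rightarrow> 'a set" where
  "ideal_pow I 0 = UNIV"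
| "ideal_pow I (Suc n) = ideal_prod I (ideal_pow I n)"

definition colon :: "'a::idom fract set \<Rightarrow> 'a fract set \<Rightarrow> 'a fract set" where
  "colon A B = {x. \<forall>b\<in>B. x * b \<in> A}"

definition finv :: "'a::idom fract set \<Rightarrow> 'a fract set" where
  "finv I = colon Rf I"

definition v_op :: "'a::idom fract set \<Rightarrow> 'a fract set" where
  "v_op I = finv (finv I)"

definition t_op :: "'a::idom fract set \<Rightarrow> 'a fract set" where
  "t_op I = \<Union>{v_op J |J. fin_gen J \<and> J \<subseteq> I}"

definition w_op :: "'a::idom fract set \<Rightarrow> 'a fract set" where
  "w_op I = \<Union>{colon I (fI J) |J. is_ideal J \<and> fin_gen (fI J) \<and> v_op (fI J) = Rf}"

definition w_reduction :: "'a::idom set \<Rightarrow> 'a set \<Rightarrow> bool" where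
  "w_reduction J I \<longleftrightarrow> is_ideal J \<and> J \<subseteq> I \<and>
     (\<exists>n. w_op (fI (ideal_prod J (ideal_pow I n))) = w_op (fI (ideal_pow I (Suc n))))"

definition w_basic :: "'a::idom set \<Rightarrow> bool" where
  "w_basic I \<longleftrightarrow> (\<forall>J. w_reduction J I \<longrightarrow> w_op (fI J) = w_op (fI I))"

definition proper_t_ideal :: "'a::idom set \<Rightarrow> bool" where
  "proper_t_ideal Q \<longleftrightarrow> is_ideal Q \<and> Q \<noteq> {0} \<and> Q \<noteq> UNIV \<and> t_op (fI Q) = fI Q"

definition maximal_t_ideal :: "'a::idom set \<Rightarrow> bool" where
  "maximal_t_ideal Q \<longleftrightarrow> proper_t_ideal Q \<and> (\<forall>Q'. proper_t_ideal Q' \<and> Q \<subseteq> Q' \<longrightarrow> Q' = Q)"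

definition prime_ideal :: "'a::idom set \<Rightarrow> bool" where
  "prime_ideal P \<longleftrightarrow> is_ideal P \<and> P \<noteq> UNIV \<and> (\<forall>a b. a * b \<in> P \<longrightarrow> a \<in> P \<or> b \<in> P)"

definition height_one :: "'a::idom set \<Rightarrow> bool" where
  "height_one P \<longleftrightarrow> prime_ideal P \<and> P \<noteq> {0} \<and>
     (\<forall>Q. prime_ideal Q \<and> Q \<subseteq> P \<longrightarrow> Q = {0} \<or> Q = P)"

definition PvMD :: "'a::idom itself \<Rightarrow> bool" where
  "PvMD _ \<longleftrightarrow> (\<forall>I::'a set. is_ideal I \<and> I \<noteq> {0} \<and> fin_gen (fI I) \<longrightarrow>
      t_op (mod_prod (fI I) (finv (fI I))) = Rf)"

definition t_dim_one :: "'a::idom itself \<Rightarrow> bool" where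
  "t_dim_one _ \<longleftrightarrow> (\<forall>M::'a set. maximal_t_ideal M \<longrightarrow> height_one M)"

end

theory Submission
  imports Defs
begin

text \<open>Write \<open>loc M L\<close> for the contraction to R of the extension of L to the localization at M.
  Then the w-closure of an ideal L is the intersection of \<open>loc M L\<close> over the maximal t-ideals M,
  and R is a PvMD iff divisibility is total up to factors outside M, for each such M.
  If moreover every M has height one, then a reduction of I that is proper at M forces, unless I is
  locally principal (where one cancels its generator),
  \<open>I\<^sup>n \<subseteq> c I\<^sup>n\<close> locally for some \<open>c \<in> M\<close>, which contradicts the archimedean property of the
  localization. Conversely, three reductions suffice: \<open>(d)\<close> of \<open>(c, d)\<close> when
  \<open>c/d\<close> is a quadratic integer, \<open>(a\<^sup>2, b\<^sup>2)\<close> of \<open>(a, b)\<^sup>2\<close>, and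
  \<open>bR\<^sub>M \<inter> R\<close> of \<open>bR\<^sub>P \<inter> R\<close> for a nonzero prime P below M containing b.\<close>

section \<open>The embedding into the quotient field, submodules and their spans\<close>

lemma emb_simps [simp]:
  "emb 0 = 0" "emb 1 = 1" "emb (a + b) = emb a + emb b" "emb (a * b) = emb a * emb b"
  by (simp_all add: emb_def Zero_fract_def One_fract_def)

lemma emb_eq_iff [simp]: "emb a = emb b \<longleftrightarrow> a = b"
  by (simp add: emb_def eq_fract)

lemma emb_image_iff [simp]: "emb a \<in> emb ` A \<longleftrightarrow> a \<in> A"
  by auto

lemma emb_in_Rf [simp]: "emb a \<in> Rf"
  by (simp add: Rf_def)

lemma Fract_mult_emb_in_Rf:
  assumes "b \<noteq> 0"
  shows "Fract a b * emb g \<in> Rf \<longleftrightarrow> b dvd a * g"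
  using assms by (auto simp: Rf_def emb_def eq_fract dvd_def mult_ac)

definition submodule :: "'a::idom fract set \<Rightarrow> bool" where
  "submodule N \<longleftrightarrow> 0 \<in> N \<and> (\<forall>x\<in>N. \<forall>y\<in>N. x + y \<in> N) \<and> (\<forall>r. \<forall>x\<in>N. emb r * x \<in> N)"

lemma submodule_emb_image: "is_ideal I \<Longrightarrow> submodule (emb ` I)"
  unfolding submodule_def is_ideal_def
  by (auto simp flip: emb_simps)

lemma submodule_Rf: "submodule Rf"
  unfolding Rf_def by (rule submodule_emb_image) (simp add: is_ideal_def)

lemma submodule_scaled: "submodule N \<Longrightarrow> submodule {y. x * y \<in> N}"
  unfolding submodule_def by (simp add: distrib_left mult.left_commute[of x])

lemma ideal_emb_vimage: "submodule N \<Longrightarrow> is_ideal {r. emb r \<in> N}"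
  unfolding submodule_def is_ideal_def by auto

lemma rspan_superset: "S \<subseteq> rspan S"
proof
  fix x assume "x \<in> S"
  then show "x \<in> rspan S"
    unfolding rspan_def by (intro CollectI exI[of _ "{x}"] exI[of _ "\<lambda>_. 1"]) auto
qed

lemma rspan_least:
  assumes "S \<subseteq> N" "submodule N"
  shows "rspan S \<subseteq> N"
proof
  fix x assume "x \<in> rspan S"
  then obtain F c where F: "finite F" "F \<subseteq> S" "x = (\<Sum>s\<in>F. emb (c s) * s)"
    unfolding rspan_def by blast
  have "(\<Sum>s\<in>F. emb (c s) * s) \<in> N"
    using F(1,2)
    by (induction F rule: finite_induct) (use assms in \<open>auto simp: submodule_def\<close>)
  with F show "x \<in> N" by simp
qed

lemma submodule_rspan: "submodule (rspan S)"
  unfolding submodule_def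
proof (intro conjI ballI allI)
  show "0 \<in> rspan S"
    unfolding rspan_def by (intro CollectI exI[of _ "{}"]) auto
next
  fix x y assume "x \<in> rspan S" "y \<in> rspan S"
  then obtain F c G d where F: "finite F" "F \<subseteq> S" "x = (\<Sum>s\<in>F. emb (c s) * s)"
    and G: "finite G" "G \<subseteq> S" "y = (\<Sum>s\<in>G. emb (d s) * s)"
    unfolding rspan_def by blast
  let ?c = "\<lambda>s. if s \<in> F then c s else 0" and ?d = "\<lambda>s. if s \<in> G then d s else 0"
  have x: "x = (\<Sum>s\<in>F \<union> G. emb (?c s) * s)"
    unfolding F(3) using F G by (intro sum.mono_neutral_cong_left) auto
  have y: "y = (\<Sum>s\<in>F \<union> G. emb (?d s) * s)"
    unfolding G(3) using F G by (intro sum.mono_neutral_cong_left) auto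
  have "x + y = (\<Sum>s\<in>F \<union> G. emb (?c s + ?d s) * s)"
    unfolding x y sum.distrib[symmetric] by (intro sum.cong) (simp_all only: emb_simps distrib_right)
  then show "x + y \<in> rspan S"
    unfolding rspan_def using F G
    by (intro CollectI exI[of _ "F \<union> G"] exI[of _ "\<lambda>s. ?c s + ?d s"]) auto
next
  fix r x assume "x \<in> rspan S"
  then obtain F c where F: "finite F" "F \<subseteq> S" "x = (\<Sum>s\<in>F. emb (c s) * s)"
    unfolding rspan_def by blast
  then have "emb r * x = (\<Sum>s\<in>F. emb (r * c s) * s)"
    by (simp add: sum_distrib_left mult_ac)
  with F show "emb r * x \<in> rspan S"
    unfolding rspan_def by (intro CollectI exI[of _ F] exI[of _ "\<lambda>s. r * c s"]) auto
qed

text \<open>Multiplication by \<open>x\<close> is linear, so the elements that it sends into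
  \<open>N\<close> form a submodule, and testing the generators is enough.\<close>

lemma colon_rspan:
  assumes "submodule N"
  shows "colon N (rspan S) = {x. \<forall>s\<in>S. x * s \<in> N}"
proof -
  have "x * b \<in> N" if "\<forall>s\<in>S. x * s \<in> N" "b \<in> rspan S" for x b
    using rspan_least[OF _ submodule_scaled[OF assms], of S x] that by blast
  then show ?thesis
    using rspan_superset[of S] unfolding colon_def by blast
qed

text \<open>Taking the span in the quotient field and pulling it back makes finite generation in the
  sense of \<open>fin_gen\<close> immediate through \<open>fI_gen\<close>.\<close>

definition gen :: "'a::idom set \<Rightarrow> 'a set" where
  "gen G = {r. emb r \<in> rspan (emb ` G)}"

lemma ideal_gen: "is_ideal (gen G)"
  unfolding gen_def by (rule ideal_emb_vimage[OF submodule_rspan])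

lemma gen_superset: "G \<subseteq> gen G"
  unfolding gen_def using rspan_superset[of "emb ` G"] by blast

lemma gen_least: "G \<subseteq> I \<Longrightarrow> is_ideal I \<Longrightarrow> gen G \<subseteq> I"
  using rspan_least[OF image_mono submodule_emb_image, of G I] unfolding gen_def
  by (metis (no_types, lifting) emb_image_iff mem_Collect_eq subsetD subsetI)

lemma fI_gen: "fI (gen G) = rspan (emb ` G)"
proof -
  have "rspan (emb ` G) \<subseteq> Rf"
    by (rule rspan_least[OF _ submodule_Rf]) auto
  then show ?thesis
    unfolding fI_def gen_def Rf_def by auto
qed

text \<open>Lets the finite generating sets in the definitions of t and w, which live in the
  quotient field, be replaced by finite subsets of the ring.\<close>

lemma rspan_subset_fI:
  assumes "finite F" "rspan F \<subseteq> fI I"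
  obtains G where "finite G" "G \<subseteq> I" "F = emb ` G"
proof -
  have "F \<subseteq> emb ` I"
    using assms rspan_superset unfolding fI_def by blast
  then show thesis
    using that assms(1) by (metis finite_subset_image)
qed


subsection \<open>The closure operations inside the ring\<close>

text \<open>As \<open>a/b\<close> ranges over the quotient field, \<open>vcl G\<close> is \<open>(G)\<^sub>v\<close>, and \<open>gv F\<close> says that
  F generates an ideal with trivial v-closure.\<close>

definition vcl :: "'a::idom set \<Rightarrow> 'a set" where
  "vcl G = {r. \<forall>a b. b \<noteq> 0 \<longrightarrow> (\<forall>g\<in>G. b dvd a * g) \<longrightarrow> b dvd a * r}"

definition gv :: "'a::idom set \<Rightarrow> bool" where
  "gv F \<longleftrightarrow> finite F \<and> 1 \<in> vcl F"

definition wcl :: "'a::idom set \<Rightarrow> 'a set" where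
  "wcl I = {x. \<exists>F. gv F \<and> (\<forall>f\<in>F. f * x \<in> I)}"

lemma vclD: "r \<in> vcl G \<Longrightarrow> b \<noteq> 0 \<Longrightarrow> (\<And>g. g \<in> G \<Longrightarrow> b dvd a * g) \<Longrightarrow> b dvd a * r"
  unfolding vcl_def by blast

lemma gvD:
  assumes "gv F" "b \<noteq> 0" "\<And>f. f \<in> F \<Longrightarrow> b dvd a * f"
  shows "b dvd a"
  using vclD[of 1 F b a] assms unfolding gv_def by simp

lemma gvI:
  assumes "finite F" "\<And>a b. b \<noteq> 0 \<Longrightarrow> \<forall>f\<in>F. b dvd a * f \<Longrightarrow> b dvd a"
  shows "gv F"
proof -
  have "1 \<in> vcl F"
    unfolding vcl_def mem_Collect_eq mult_1_right using assms(2) by (intro allI impI)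
  with assms(1) show ?thesis
    by (simp add: gv_def)
qed

lemma v_op_rspan_emb: "v_op (rspan (emb ` G)) = emb ` vcl G"
proof -
  have "finv (rspan (emb ` G)) = {x. \<forall>g\<in>G. x * emb g \<in> Rf}"
    unfolding finv_def colon_rspan[OF submodule_Rf] by blast
  then have v: "y \<in> v_op (rspan (emb ` G)) \<longleftrightarrow> (\<forall>x. (\<forall>g\<in>G. x * emb g \<in> Rf) \<longrightarrow> x * y \<in> Rf)" for y
    unfolding v_op_def by (subst finv_def) (auto simp: colon_def mult.commute)
  \<comment> \<open>Since \<open>G\<close> lies in R, 1 belongs to the inverse; hence the v-closure
    stays inside R.\<close>
  have "y \<in> Rf" if "y \<in> v_op (rspan (emb ` G))" for y
    using that unfolding v by (auto dest: spec[of _ 1])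
  moreover have "emb r \<in> v_op (rspan (emb ` G)) \<longleftrightarrow> r \<in> vcl G" for r
  proof -
    have "emb r \<in> v_op (rspan (emb ` G)) \<longleftrightarrow>
        (\<forall>a b. b \<noteq> 0 \<longrightarrow> (\<forall>g\<in>G. Fract a b * emb g \<in> Rf) \<longrightarrow> Fract a b * emb r \<in> Rf)"
      unfolding v by (metis Fract_cases)
    then show ?thesis
      unfolding vcl_def by (simp add: Fract_mult_emb_in_Rf)
  qed
  ultimately show ?thesis
    unfolding Rf_def by blast
qed

lemma vcl_eq_UNIV_iff: "vcl G = UNIV \<longleftrightarrow> 1 \<in> vcl G"
proof
  assume one: "1 \<in> vcl G"
  have "r \<in> vcl G" for r
    unfolding vcl_def
  proof (intro CollectI allI impI)
    fix a b :: 'a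
    assume "b \<noteq> 0" "\<forall>g\<in>G. b dvd a * g"
    then have "b dvd a * 1"
      by (intro vclD[OF one]) auto
    then show "b dvd a * r"
      by simp
  qed
  then show "vcl G = UNIV"
    by blast
qed simp

lemma v_op_eq_Rf_iff: "finite G \<Longrightarrow> v_op (rspan (emb ` G)) = Rf \<longleftrightarrow> gv G"
  unfolding v_op_rspan_emb gv_def vcl_eq_UNIV_iff[symmetric] Rf_def
  by (auto simp: inj_image_eq_iff inj_on_def)

text \<open>An element y = a/b of the w-closure multiplies some \<open>gv\<close> set
  \<open>G\<close> into \<open>I\<close>, hence into R; by \<open>gvD\<close> this gives
  \<open>b dvd a\<close>, so y already lies in R. Conversely \<open>gen G\<close> serves as the
  ideal \<open>J\<close> in the definition of w.\<close>

lemma w_op_fI: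
  assumes I: "is_ideal I"
  shows "w_op (fI I) = emb ` wcl I"
proof
  show "w_op (fI I) \<subseteq> emb ` wcl I"
  proof
    fix y assume "y \<in> w_op (fI I)"
    then obtain J F where y: "y \<in> colon (fI I) (fI J)" and F: "finite F" "fI J = rspan F"
      and v: "v_op (fI J) = Rf"
      unfolding w_op_def fin_gen_def by blast
    obtain G where G: "finite G" "G \<subseteq> J" "F = emb ` G"
      using rspan_subset_fI[of F J] F by blast
    have gvG: "gv G"
      using v_op_eq_Rf_iff[OF G(1)] v F G by simp
    have yG: "\<forall>g\<in>G. y * emb g \<in> emb ` I"
      using y G by (auto simp: colon_def fI_def)
    obtain a b where ab: "y = Fract a b" "b \<noteq> 0"
      by (cases y) auto
    have "b dvd a"
      using gvG ab(2)
    proof (rule gvD)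
      fix g assume "g \<in> G"
      then have "Fract a b * emb g \<in> Rf"
        using yG ab by (auto simp: Rf_def)
      then show "b dvd a * g"
        using ab by (simp add: Fract_mult_emb_in_Rf)
    qed
    then obtain r where r: "y = emb r"
      using ab by (auto simp: emb_def eq_fract mult_ac)
    have "\<forall>g\<in>G. g * r \<in> I"
      using yG unfolding r by (simp add: mult.commute flip: emb_simps)
    then show "y \<in> emb ` wcl I"
      using gvG r unfolding wcl_def by blast
  qed
  show "emb ` wcl I \<subseteq> w_op (fI I)"
  proof
    fix y assume "y \<in> emb ` wcl I"
    then obtain x G where y: "y = emb x" and G: "gv G" "\<forall>g\<in>G. g * x \<in> I"
      unfolding wcl_def by blast
    have fin: "finite G"
      using G(1) gv_def by blast
    have "y \<in> colon (fI I) (fI (gen G))"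
      unfolding fI_gen unfolding fI_def colon_rspan[OF submodule_emb_image[OF I]] y
      using G(2) by (simp add: mult.commute flip: emb_simps)
    moreover have "fin_gen (fI (gen G))" "v_op (fI (gen G)) = Rf"
      unfolding fI_gen fin_gen_def using fin G v_op_eq_Rf_iff by auto
    ultimately show "y \<in> w_op (fI I)"
      unfolding w_op_def using ideal_gen by blast
  qed
qed

lemma w_op_fI_eq_iff:
  "is_ideal I \<Longrightarrow> is_ideal J \<Longrightarrow> w_op (fI I) = w_op (fI J) \<longleftrightarrow> wcl I = wcl J"
  by (simp add: w_op_fI inj_image_eq_iff inj_on_def)

lemma t_op_fI: "is_ideal I \<Longrightarrow> t_op (fI I) = emb ` (\<Union>{vcl G |G. finite G \<and> G \<subseteq> I})"
proof (intro equalityI subsetI)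
  fix y assume I: "is_ideal I" and "y \<in> t_op (fI I)"
  then obtain F where F: "finite F" "rspan F \<subseteq> fI I" and y: "y \<in> v_op (rspan F)"
    unfolding t_op_def fin_gen_def by blast
  then obtain G where "finite G" "G \<subseteq> I" "F = emb ` G"
    using rspan_subset_fI by metis
  with y show "y \<in> emb ` (\<Union>{vcl G |G. finite G \<and> G \<subseteq> I})"
    by (auto simp: v_op_rspan_emb)
next
  fix y assume I: "is_ideal I" and "y \<in> emb ` (\<Union>{vcl G |G. finite G \<and> G \<subseteq> I})"
  then obtain G where G: "finite G" "G \<subseteq> I" and y: "y \<in> v_op (rspan (emb ` G))"
    unfolding v_op_rspan_emb by blast
  have "rspan (emb ` G) \<subseteq> fI I"
    unfolding fI_gen[symmetric] using gen_least[OF G(2) I] by (auto simp: fI_def)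
  moreover have "fin_gen (rspan (emb ` G))"
    unfolding fin_gen_def using G by blast
  ultimately show "y \<in> t_op (fI I)"
    unfolding t_op_def using y by blast
qed

text \<open>A single v-closure containing 1 is all of R. From here on an ideal is seen to be proper
  for t by its containing no \<open>gv\<close> set.\<close>

lemma t_op_fI_eq_Rf_iff:
  assumes "is_ideal I"
  shows "t_op (fI I) = Rf \<longleftrightarrow> (\<exists>F. gv F \<and> F \<subseteq> I)"
proof -
  have "t_op (fI I) = Rf \<longleftrightarrow> (\<Union>{vcl G |G. finite G \<and> G \<subseteq> I}) = UNIV"
    unfolding t_op_fI[OF assms] Rf_def by (auto simp: inj_image_eq_iff inj_on_def)
  also have "\<dots> \<longleftrightarrow> 1 \<in> (\<Union>{vcl G |G. finite G \<and> G \<subseteq> I})"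
    using vcl_eq_UNIV_iff by blast
  also have "\<dots> \<longleftrightarrow> (\<exists>F. gv F \<and> F \<subseteq> I)"
    unfolding gv_def by blast
  finally show ?thesis .
qed

text \<open>Cancel first \<open>G\<close>, then \<open>F\<close>. Closure under products is what
  makes an ideal maximal without \<open>gv\<close> subsets prime.\<close>

lemma gv_mult:
  assumes "gv F" "gv G"
  shows "gv {f * g |f g. f \<in> F \<and> g \<in> G}"
proof (rule gvI)
  have "{f * g |f g. f \<in> F \<and> g \<in> G} = (\<lambda>(f, g). f * g) ` (F \<times> G)"
    by auto
  then show "finite {f * g |f g. f \<in> F \<and> g \<in> G}"
    using assms by (simp add: gv_def)
next
  fix a b :: 'a
  assume b: "b \<noteq> 0" and d: "\<forall>h\<in>{f * g |f g. f \<in> F \<and> g \<in> G}. b dvd a * h"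
  show "b dvd a"
    using assms(1) b
  proof (rule gvD)
    fix f assume f: "f \<in> F"
    show "b dvd a * f"
      using assms(2) b
    proof (rule gvD)
      fix g assume "g \<in> G"
      then have "b dvd a * (f * g)"
        using d f by blast
      then show "b dvd a * f * g"
        by (simp add: mult.assoc)
    qed
  qed
qed

lemma gv_one: "gv {1}"
  by (rule gvI) auto


subsection \<open>Maximal t-ideals\<close>

lemma ideal_UNIV: "is_ideal UNIV"
  by (simp add: is_ideal_def)

lemma ideal_mult_right: "is_ideal I \<Longrightarrow> x \<in> I \<Longrightarrow> x * r \<in> I"
  unfolding is_ideal_def by (metis mult.commute)

lemma ideal_mult_left: "is_ideal I \<Longrightarrow> x \<in> I \<Longrightarrow> r * x \<in> I"
  unfolding is_ideal_def by blast

lemma ideal_add: "is_ideal I \<Longrightarrow> x \<in> I \<Longrightarrow> y \<in> I \<Longrightarrow> x + y \<in> I"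
  unfolding is_ideal_def by blast

lemma ideal_zero: "is_ideal I \<Longrightarrow> 0 \<in> I"
  unfolding is_ideal_def by blast

lemma ideal_multiples: "is_ideal {x. d dvd x}"
  by (simp add: is_ideal_def)

definition adjoin :: "'a::idom set \<Rightarrow> 'a \<Rightarrow> 'a set" where
  "adjoin M a = {m + r * a |m r. m \<in> M}"

lemma adjoin:
  assumes M: "is_ideal M"
  shows "is_ideal (adjoin M a)" "M \<subseteq> adjoin M a" "a \<in> adjoin M a"
proof -
  show "M \<subseteq> adjoin M a"
    unfolding adjoin_def by (fastforce intro: exI[of _ 0])
  show "a \<in> adjoin M a"
    using ideal_zero[OF M] unfolding adjoin_def
    by (intro CollectI exI[of _ 0] exI[of _ 1]) simp
  show "is_ideal (adjoin M a)"
    unfolding is_ideal_def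
  proof (intro conjI ballI allI impI)
    show "0 \<in> adjoin M a"
      using ideal_zero[OF M] \<open>M \<subseteq> adjoin M a\<close> by blast
  next
    fix x y assume "x \<in> adjoin M a" "y \<in> adjoin M a"
    then obtain m r m' r' where "m \<in> M" "x = m + r * a" "m' \<in> M" "y = m' + r' * a"
      unfolding adjoin_def by blast
    then show "x + y \<in> adjoin M a"
      unfolding adjoin_def using ideal_add[OF M, of m m']
      by (intro CollectI exI[of _ "m + m'"] exI[of _ "r + r'"]) (simp add: algebra_simps)
  next
    fix s x assume "x \<in> adjoin M a"
    then obtain m r where "m \<in> M" "x = m + r * a"
      unfolding adjoin_def by blast
    then show "s * x \<in> adjoin M a"
      unfolding adjoin_def using ideal_mult_left[OF M, of m s]
      by (intro CollectI exI[of _ "s * m"] exI[of _ "s * r"]) (simp add: algebra_simps)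
  qed
qed

lemma ideal_Union_chain:
  assumes "subset.chain {I. is_ideal I} C" "C \<noteq> {}"
  shows "is_ideal (\<Union>C)"
proof -
  have id: "is_ideal I" if "I \<in> C" for I
    using assms(1) that by (auto simp: subset_chain_def)
  have "x + y \<in> \<Union>C" if "x \<in> \<Union>C" "y \<in> \<Union>C" for x y
  proof -
    obtain I J where "I \<in> C" "J \<in> C" "x \<in> I" "y \<in> J"
      using \<open>x \<in> \<Union>C\<close> \<open>y \<in> \<Union>C\<close> by blast
    moreover from this have "I \<subseteq> J \<or> J \<subseteq> I"
      using assms(1) by (auto simp: subset_chain_def)
    ultimately show ?thesis
      using id by (metis UnionI ideal_add subsetD)
  qed
  then show ?thesis
    using id assms(2) ideal_zero ideal_mult_left unfolding is_ideal_def
    by (metis UnionE UnionI equals0I)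
qed

text \<open>Both Krull's lemma (for the singletons of a multiplicative set) and the primality of
  maximal t-ideals (for the finite sets generating an ideal with trivial v-closure).\<close>

lemma prime_ideal_avoiding:
  assumes L: "is_ideal L" and avoid: "\<And>F. F \<in> \<F> \<Longrightarrow> finite F \<and> \<not> F \<subseteq> L"
    and ne: "\<F> \<noteq> {}"
    and mult: "\<And>F G. F \<in> \<F> \<Longrightarrow> G \<in> \<F> \<Longrightarrow> {f * g |f g. f \<in> F \<and> g \<in> G} \<in> \<F>"
  obtains M where "L \<subseteq> M" "prime_ideal M" "\<And>F. F \<in> \<F> \<Longrightarrow> \<not> F \<subseteq> M"
    "\<And>N. is_ideal N \<Longrightarrow> M \<subset> N \<Longrightarrow> \<exists>F\<in>\<F>. F \<subseteq> N"
proof -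
  let ?A = "{I. is_ideal I \<and> L \<subseteq> I \<and> (\<forall>F\<in>\<F>. \<not> F \<subseteq> I)}"
  have "\<exists>M\<in>?A. \<forall>X\<in>?A. M \<subseteq> X \<longrightarrow> X = M"
  proof (rule subset_Zorn_nonempty)
    show "?A \<noteq> {}"
      using L avoid by blast
  next
    fix C assume C: "C \<noteq> {}" "subset.chain ?A C"
    have "is_ideal (\<Union>C)"
      by (rule ideal_Union_chain) (use C in \<open>auto simp: subset_chain_def\<close>)
    moreover have "L \<subseteq> \<Union>C"
      using C unfolding subset_chain_def by blast
    moreover have "\<not> F \<subseteq> \<Union>C" if "F \<in> \<F>" for F
    proof
      assume "F \<subseteq> \<Union>C"
      \<comment> \<open>A finite set covered by a chain lies in one member; this is where finiteness
        of the sets to be avoided enters.\<close>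
      moreover have "finite F"
        using avoid \<open>F \<in> \<F>\<close> by blast
      ultimately obtain I where "I \<in> C" "F \<subseteq> I"
        using finite_subset_Union_chain[of F C ?A] C by blast
      then show False
        using that C by (auto simp: subset_chain_def)
    qed
    ultimately show "\<Union>C \<in> ?A"
      by blast
  qed
  then obtain M where M: "is_ideal M" "L \<subseteq> M" "\<forall>F\<in>\<F>. \<not> F \<subseteq> M"
    and max: "\<forall>X\<in>?A. M \<subseteq> X \<longrightarrow> X = M"
    by blast
  have ex: "\<exists>F\<in>\<F>. F \<subseteq> N" if "is_ideal N" "M \<subset> N" for N
  proof (rule ccontr)
    assume "\<not> ?thesis"
    then have "N \<in> ?A"
      using that M(2) by blast
    then show False
      using max \<open>M \<subset> N\<close> by blast
  qed
  have "prime_ideal M"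
    unfolding prime_ideal_def
  proof (intro conjI allI impI)
    show "is_ideal M" by fact
    show "M \<noteq> UNIV"
      using M(3) ne by blast
    fix a b assume ab: "a * b \<in> M"
    show "a \<in> M \<or> b \<in> M"
    proof (rule ccontr)
      assume "\<not> (a \<in> M \<or> b \<in> M)"
      then have "M \<subset> adjoin M a" "M \<subset> adjoin M b"
        using adjoin[OF M(1)] by blast+
      then obtain F G where FG: "F \<in> \<F>" "F \<subseteq> adjoin M a" "G \<in> \<F>" "G \<subseteq> adjoin M b"
        using ex adjoin(1)[OF M(1)] by meson
      have "f * g \<in> M" if fg: "f \<in> F" "g \<in> G" for f g
      proof -
        have "f \<in> adjoin M a" "g \<in> adjoin M b"
          using FG fg by blast+
        then obtain m r m' r' where "m \<in> M" "f = m + r * a" "m' \<in> M" "g = m' + r' * b"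
          unfolding adjoin_def by blast
        \<comment> \<open>Each summand has one of the factors \<open>m\<close>, \<open>m'\<close>
          and \<open>a * b\<close>, all in \<open>M\<close>.\<close>
        moreover from this have "f * g = g * m + (r * a * m' + r * r' * (a * b))"
          by (simp add: algebra_simps)
        ultimately show ?thesis
          using ab M(1) by (simp add: ideal_add ideal_mult_left)
      qed
      then have "{f * g |f g. f \<in> F \<and> g \<in> G} \<subseteq> M"
        by blast
      then show False
        using M(3) mult[OF FG(1,3)] by blast
    qed
  qed
  then show thesis
    using that[of M] M ex by blast
qed

text \<open>Maximality among all ideals without \<open>gv\<close> subsets already forces
  t-closedness: an element of a v-closure outside \<open>M\<close> could be adjoined to
  \<open>M\<close>, and the resulting \<open>gv\<close> set could be pushed back into
  \<open>M\<close>. A larger proper t-ideal would contain a \<open>gv\<close> set and so be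
  R.\<close>

lemma maximal_t_idealI:
  fixes M :: "'a::idom set"
  assumes M: "is_ideal M" and no: "\<And>F. gv F \<Longrightarrow> \<not> F \<subseteq> M"
    and max: "\<And>N. is_ideal N \<Longrightarrow> M \<subset> N \<Longrightarrow> \<exists>F. gv F \<and> F \<subseteq> N"
  shows "maximal_t_ideal M"
proof -
  have "M \<noteq> {0}"
  proof
    assume "M = {0}"
    then have "\<not> gv ({0} :: 'a set)"
      using no by blast
    \<comment> \<open>In a field even \<open>{0}\<close> is a \<open>gv\<close> set, so here some
      nonzero \<open>b\<close> is not a unit. The ideal (b) then contains a \<open>gv\<close> set,
      which forces \<open>b dvd 1\<close>.\<close>
    have "\<exists>b :: 'a. b \<noteq> 0 \<and> \<not> b dvd 1"
    proof (rule ccontr)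
      assume "\<nexists>b :: 'a. b \<noteq> 0 \<and> \<not> b dvd 1"
      then have "b dvd a" if "b \<noteq> 0" for a b :: 'a
        using that dvd_trans one_dvd by blast
      then have "gv {0 :: 'a}"
        by (intro gvI) blast+
      with \<open>\<not> gv {0}\<close> show False
        by blast
    qed
    then obtain b :: 'a where b: "b \<noteq> 0" "\<not> b dvd 1"
      by blast
    then have "M \<subseteq> {x. b dvd x}" "b \<notin> M" "b \<in> {x. b dvd x}"
      using \<open>M = {0}\<close> by auto
    then have "M \<subset> {x. b dvd x}"
      by blast
    then obtain F where "gv F" "F \<subseteq> {x. b dvd x}"
      using max[OF ideal_multiples] by blast
    then have "b dvd 1"
      by (intro gvD[of F b 1]) (use b in auto)
    with b show False
      by blast
  qed
  moreover have "M \<noteq> UNIV"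
    using no gv_one by blast
  moreover have "t_op (fI M) = fI M"
  proof -
    have t: "r \<in> M" if G: "finite G" "G \<subseteq> M" and r: "r \<in> vcl G" for r G
    proof (rule ccontr)
      assume "r \<notin> M"
      then have "M \<subset> adjoin M r"
        using adjoin[OF M] by blast
      then obtain F where F: "gv F" "F \<subseteq> adjoin M r"
        using max[OF adjoin(1)[OF M]] by blast
      then have "\<forall>f\<in>F. \<exists>m\<in>M. \<exists>c. f = m + c * r"
        unfolding adjoin_def by blast
      then obtain m c where mc: "\<And>f. f \<in> F \<Longrightarrow> m f \<in> M \<and> f = m f + c f * r"
        by metis
      \<comment> \<open>The multiples of \<open>r\<close> in the elements of \<open>F\<close> may be
        traded for \<open>G\<close>: whatever divides a times \<open>G\<close> also divides a times
        \<open>r\<close>, since \<open>r \<in> vcl G\<close>.\<close>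
      have "gv (G \<union> m ` F)"
      proof (rule gvI)
        show "finite (G \<union> m ` F)"
          using G F by (simp add: gv_def)
        fix a b :: 'a assume b: "b \<noteq> 0" and d: "\<forall>f\<in>G \<union> m ` F. b dvd a * f"
        have ar: "b dvd a * r"
          using r b d by (intro vclD[of r G]) auto
        show "b dvd a"
          using F(1) b
        proof (rule gvD)
          fix f assume f: "f \<in> F"
          have "a * f = a * m f + c f * (a * r)"
            by (subst conjunct2[OF mc[OF f]]) (simp add: algebra_simps)
          moreover have "b dvd a * m f"
            using d f by blast
          ultimately show "b dvd a * f"
            using ar by (simp only: dvd_add dvd_mult)
        qed
      qed
      moreover have "G \<union> m ` F \<subseteq> M"
        using G mc by blast
      ultimately show False
        using no by blast
    qed
    have "\<Union>{vcl G |G. finite G \<and> G \<subseteq> M} = M"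
    proof
      show "\<Union>{vcl G |G. finite G \<and> G \<subseteq> M} \<subseteq> M"
        using t by auto
    next
      have "vcl {r} \<in> {vcl G |G. finite G \<and> G \<subseteq> M}" "r \<in> vcl {r}" if "r \<in> M" for r
        using that by (auto simp: vcl_def)
      then show "M \<subseteq> \<Union>{vcl G |G. finite G \<and> G \<subseteq> M}"
        by (meson UnionI subsetI)
    qed
    then show ?thesis
      unfolding t_op_fI[OF M] by (simp add: fI_def)
  qed
  ultimately have proper: "proper_t_ideal M"
    using M unfolding proper_t_ideal_def by blast
  have "Q = M" if Q: "proper_t_ideal Q" "M \<subseteq> Q" for Q
  proof (rule ccontr)
    assume "Q \<noteq> M"
    then have "M \<subset> Q"
      using Q by blast
    then obtain F where "gv F" "F \<subseteq> Q"
      using max[of Q] Q unfolding proper_t_ideal_def by blast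
    then have "fI Q = Rf"
      using t_op_fI_eq_Rf_iff[of Q] Q unfolding proper_t_ideal_def by auto
    then show False
      using Q unfolding proper_t_ideal_def fI_def Rf_def by (auto simp: inj_image_eq_iff inj_on_def)
  qed
  then show ?thesis
    using proper unfolding maximal_t_ideal_def by blast
qed

lemma maximal_t_ideal_ideal: "maximal_t_ideal M \<Longrightarrow> is_ideal M"
  unfolding maximal_t_ideal_def proper_t_ideal_def by blast

lemma maximal_t_ideal_no_gv:
  assumes "maximal_t_ideal M" "gv F"
  shows "\<not> F \<subseteq> M"
proof
  assume "F \<subseteq> M"
  then have "fI M = Rf"
    using t_op_fI_eq_Rf_iff[of M] assms unfolding maximal_t_ideal_def proper_t_ideal_def by auto
  then show False
    using assms(1) unfolding maximal_t_ideal_def proper_t_ideal_def fI_def Rf_def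
    by (auto simp: inj_image_eq_iff inj_on_def)
qed

text \<open>Zorn's lemma in the form of \<open>prime_ideal_avoiding\<close>, with the
  \<open>gv\<close> sets as the family to be avoided.\<close>

lemma ex_maximal_t_ideal:
  assumes "is_ideal L" "\<And>F. gv F \<Longrightarrow> \<not> F \<subseteq> L"
  obtains M :: "'a::idom set" where "L \<subseteq> M" "maximal_t_ideal M" "prime_ideal M"
proof (rule prime_ideal_avoiding[of L "Collect gv"])
  show "is_ideal L" by fact
  show "finite F \<and> \<not> F \<subseteq> L" if "F \<in> Collect gv" for F
    using that assms(2)[of F] by (auto simp: gv_def)
  show "Collect gv \<noteq> ({} :: 'a set set)"
    using gv_one by blast
  show "{f * g |f g. f \<in> F \<and> g \<in> G} \<in> Collect gv"
    if "F \<in> Collect gv" "G \<in> Collect gv" for F G :: "'a set"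
    using that gv_mult[of F G] by blast
next
  fix M
  assume M: "L \<subseteq> M" "prime_ideal M" "\<And>F. F \<in> Collect gv \<Longrightarrow> \<not> F \<subseteq> M"
    "\<And>N. is_ideal N \<Longrightarrow> M \<subset> N \<Longrightarrow> \<exists>F\<in>Collect gv. F \<subseteq> N"
  have "maximal_t_ideal M"
    using M by (intro maximal_t_idealI) (auto simp: prime_ideal_def)
  with M show thesis
    by (intro that)
qed

text \<open>Applied to \<open>M\<close> itself, the existence lemma returns a prime maximal t-ideal
  above \<open>M\<close>, which can only be \<open>M\<close>.\<close>

lemma maximal_t_ideal_prime:
  assumes "maximal_t_ideal M"
  shows "prime_ideal M"
proof -
  obtain N where "M \<subseteq> N" "maximal_t_ideal N" "prime_ideal N"
    using ex_maximal_t_ideal[of M] maximal_t_ideal_ideal[OF assms] maximal_t_ideal_no_gv[OF assms]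
    by blast
  then show ?thesis
    using assms unfolding maximal_t_ideal_def by blast
qed

subsection \<open>Localization inside the ring\<close>

definition loc :: "'a::idom set \<Rightarrow> 'a set \<Rightarrow> 'a set" where
  "loc M S = {x. \<exists>s. s \<notin> M \<and> s * x \<in> S}"

lemma locI: "s \<notin> M \<Longrightarrow> s * x \<in> S \<Longrightarrow> x \<in> loc M S"
  unfolding loc_def by blast

lemma locE:
  assumes "x \<in> loc M S"
  obtains s where "s \<notin> M" "s * x \<in> S"
  using assms unfolding loc_def by blast

lemma loc_mono: "S \<subseteq> T \<Longrightarrow> loc M S \<subseteq> loc M T"
  unfolding loc_def by blast

lemma loc_antimono: "P \<subseteq> M \<Longrightarrow> loc M S \<subseteq> loc P S"
  unfolding loc_def by blast

lemma prime_ideal_ideal: "prime_ideal M \<Longrightarrow> is_ideal M"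
  unfolding prime_ideal_def by blast

lemma prime_ideal_mult_notin: "prime_ideal M \<Longrightarrow> s \<notin> M \<Longrightarrow> t \<notin> M \<Longrightarrow> s * t \<notin> M"
  unfolding prime_ideal_def by blast

lemma prime_ideal_one_notin:
  assumes "prime_ideal M"
  shows "1 \<notin> M"
proof
  assume "1 \<in> M"
  then have "r \<in> M" for r
    using ideal_mult_left[OF prime_ideal_ideal[OF assms], of 1 r] by simp
  then show False
    using assms unfolding prime_ideal_def by blast
qed

lemma loc_superset: "prime_ideal M \<Longrightarrow> S \<subseteq> loc M S"
  using prime_ideal_one_notin[of M] by (auto intro: locI[of 1])

lemma loc_idem:
  assumes "prime_ideal M"
  shows "loc M (loc M S) \<subseteq> loc M S"
proof
  fix x assume "x \<in> loc M (loc M S)"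
  then obtain s t where "s \<notin> M" "t \<notin> M" "t * (s * x) \<in> S"
    by (elim locE)
  then show "x \<in> loc M S"
    using prime_ideal_mult_notin[OF assms] by (intro locI[of "t * s"]) (auto simp: mult.assoc)
qed

lemma ideal_loc:
  assumes M: "prime_ideal M" and S: "is_ideal S"
  shows "is_ideal (loc M S)"
  unfolding is_ideal_def
proof (intro conjI ballI allI impI)
  show "0 \<in> loc M S"
    using loc_superset[OF M] ideal_zero[OF S] by blast
next
  fix x y assume "x \<in> loc M S" "y \<in> loc M S"
  then obtain s t where st: "s \<notin> M" "s * x \<in> S" "t \<notin> M" "t * y \<in> S"
    by (elim locE)
  have "t * (s * x) + s * (t * y) \<in> S"
    using ideal_add[OF S ideal_mult_left[OF S st(2)] ideal_mult_left[OF S st(4)]] .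
  then show "x + y \<in> loc M S"
    using prime_ideal_mult_notin[OF M st(1,3)]
    by (intro locI[of "s * t"]) (simp_all add: algebra_simps)
next
  fix r x assume "x \<in> loc M S"
  then obtain s where s: "s \<notin> M" "s * x \<in> S"
    by (elim locE)
  then show "r * x \<in> loc M S"
    using ideal_mult_left[OF S, of "s * x" r] by (intro locI[of s]) (simp_all add: mult.left_commute)
qed

lemma loc_mult:
  assumes "prime_ideal M" "x \<in> loc M S" "y \<in> loc M T" "\<And>a b. a \<in> S \<Longrightarrow> b \<in> T \<Longrightarrow> a * b \<in> U"
  shows "x * y \<in> loc M U"
proof -
  obtain s t where st: "s \<notin> M" "s * x \<in> S" "t \<notin> M" "t * y \<in> T"
    using assms(2,3) by (elim locE)
  then show ?thesis
    using prime_ideal_mult_notin[OF assms(1) st(1,3)] assms(4)[OF st(2,4)]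
    by (intro locI[of "s * t"]) (simp_all add: mult_ac)
qed

text \<open>A \<open>gv\<close> set is contained in no maximal t-ideal, so one of its elements can
  be inverted at \<open>N\<close>. Conversely, if \<open>x\<close> is not in the w-closure, then the
  ideal (L : x) contains no \<open>gv\<close> set and lies in some maximal t-ideal, at which
  \<open>x\<close> fails to be in \<open>L\<close>.\<close>

lemma wcl_iff_loc:
  assumes L: "is_ideal L"
  shows "x \<in> wcl L \<longleftrightarrow> (\<forall>N. maximal_t_ideal N \<longrightarrow> x \<in> loc N L)"
proof
  assume "x \<in> wcl L"
  then obtain F where F: "gv F" "\<forall>f\<in>F. f * x \<in> L"
    unfolding wcl_def by blast
  show "\<forall>N. maximal_t_ideal N \<longrightarrow> x \<in> loc N L"
  proof (intro allI impI)
    fix N :: "'a set" assume "maximal_t_ideal N"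
    then have "\<not> F \<subseteq> N"
      using F maximal_t_ideal_no_gv by blast
    then show "x \<in> loc N L"
      using F by (auto intro: locI)
  qed
next
  assume x: "\<forall>N. maximal_t_ideal N \<longrightarrow> x \<in> loc N L"
  let ?C = "{r. r * x \<in> L}"
  have C: "is_ideal ?C"
    using L unfolding is_ideal_def by (auto simp: distrib_right mult.assoc)
  show "x \<in> wcl L"
  proof (rule ccontr)
    assume "x \<notin> wcl L"
    then have "\<not> F \<subseteq> ?C" if "gv F" for F
      using that unfolding wcl_def by blast
    then obtain N where N: "?C \<subseteq> N" "maximal_t_ideal N"
      using ex_maximal_t_ideal[OF C] by blast
    then have "x \<in> loc N L"
      using x by blast
    then show False
      using N(1) by (elim locE) blast
  qed
qed

lemma wcl_superset: "is_ideal L \<Longrightarrow> L \<subseteq> wcl L"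
  using loc_superset[OF maximal_t_ideal_prime] by (fastforce simp: wcl_iff_loc)

lemma wcl_mono: "S \<subseteq> T \<Longrightarrow> wcl S \<subseteq> wcl T"
  unfolding wcl_def by blast

lemma wcl_least:
  assumes "is_ideal S" "is_ideal T" "S \<subseteq> wcl T"
  shows "wcl S \<subseteq> wcl T"
proof
  fix x assume x: "x \<in> wcl S"
  show "x \<in> wcl T"
    unfolding wcl_iff_loc[OF assms(2)]
  proof (intro allI impI)
    fix N :: "'a set" assume N: "maximal_t_ideal N"
    have "S \<subseteq> loc N T"
      using assms(3) N wcl_iff_loc[OF assms(2)] by blast
    then have "loc N S \<subseteq> loc N T"
      using loc_mono loc_idem[OF maximal_t_ideal_prime[OF N]] by blast
    then show "x \<in> loc N T"
      using x N wcl_iff_loc[OF assms(1)] by blast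
  qed
qed


subsection \<open>Reductions\<close>

lemma ideal_ideal_prod: "is_ideal (ideal_prod I J)"
  unfolding ideal_prod_def is_ideal_def by auto

lemma ideal_prodI: "a \<in> I \<Longrightarrow> b \<in> J \<Longrightarrow> a * b \<in> ideal_prod I J"
  unfolding ideal_prod_def by blast

lemma ideal_prod_least:
  assumes "is_ideal L" "\<And>a b. a \<in> I \<Longrightarrow> b \<in> J \<Longrightarrow> a * b \<in> L"
  shows "ideal_prod I J \<subseteq> L"
  unfolding ideal_prod_def using assms by (intro Inter_lower) auto

lemma ideal_prod_mono: "I \<subseteq> I' \<Longrightarrow> J \<subseteq> J' \<Longrightarrow> ideal_prod I J \<subseteq> ideal_prod I' J'"
  by (intro ideal_prod_least ideal_ideal_prod) (auto intro: ideal_prodI)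

lemma ideal_prod_UNIV:
  assumes "is_ideal I"
  shows "ideal_prod I UNIV = I"
proof
  show "ideal_prod I UNIV \<subseteq> I"
    using assms by (intro ideal_prod_least) (auto intro: ideal_mult_right)
  show "I \<subseteq> ideal_prod I UNIV"
    using ideal_prodI[of _ I 1 UNIV] by auto
qed

lemma ideal_ideal_pow: "is_ideal (ideal_pow I n)"
  by (cases n) (simp_all add: ideal_UNIV ideal_ideal_prod)

lemma power_in_ideal_pow: "x \<in> I \<Longrightarrow> x ^ n \<in> ideal_pow I n"
  by (induction n) (simp_all add: ideal_prodI)

text \<open>The only way in which w-basicness is exploited: all reductions needed have exponent n =
  1, and the inclusion of I^2 in the w-closure of JI is tested on products of elements.\<close>

lemma w_basic_wcl_eq:
  assumes basic: "w_basic I" and I: "is_ideal I" and J: "is_ideal J" "J \<subseteq> I"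
    and prod: "\<And>x y. x \<in> I \<Longrightarrow> y \<in> I \<Longrightarrow> x * y \<in> wcl (ideal_prod J I)"
  shows "wcl J = wcl I"
proof -
  \<comment> \<open>The w-closure is an intersection of contractions, each of which is an
    ideal.\<close>
  have wcl: "is_ideal (wcl (ideal_prod J I))"
    using ideal_loc[OF maximal_t_ideal_prime ideal_ideal_prod, of _ J I]
    unfolding is_ideal_def Ball_def wcl_iff_loc[OF ideal_ideal_prod] by simp
  have "wcl (ideal_prod J I) = wcl (ideal_prod I I)"
  proof
    show "wcl (ideal_prod J I) \<subseteq> wcl (ideal_prod I I)"
      using J by (intro wcl_mono ideal_prod_mono) auto
    show "wcl (ideal_prod I I) \<subseteq> wcl (ideal_prod J I)"
      using prod wcl by (intro wcl_least ideal_ideal_prod ideal_prod_least)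
  qed
  then have "w_reduction J I"
    unfolding w_reduction_def using J
    by (intro conjI exI[of _ 1])
      (simp_all add: ideal_prod_UNIV I w_op_fI_eq_iff ideal_ideal_prod)
  then show ?thesis
    using basic unfolding w_basic_def w_op_fI_eq_iff[OF J(1) I, symmetric] by blast
qed


subsection \<open>From valuation localizations of height one to w-basic ideals\<close>

text \<open>Otherwise Krull's lemma gives a prime \<open>Q\<close> containing \<open>b\<close> and
  avoiding the multiplicative set of all \<open>s * a ^ k\<close>. It is nonzero and strictly inside
  \<open>M\<close>, against height one.\<close>

lemma height_one_archimedean:
  assumes M: "height_one M" and a: "a \<in> M" and b: "b \<noteq> 0"
  shows "\<exists>s k. s \<notin> M \<and> b dvd s * a ^ k"
proof (rule ccontr)
  assume no: "\<nexists>s k. s \<notin> M \<and> b dvd s * a ^ k"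
  have prime: "prime_ideal M"
    using M unfolding height_one_def by blast
  show False
  proof (rule prime_ideal_avoiding[of "{x. b dvd x}" "{{s * a ^ k} |s k. s \<notin> M}"])
    show "is_ideal {x. b dvd x}"
      by (rule ideal_multiples)
    show "finite F \<and> \<not> F \<subseteq> {x. b dvd x}" if "F \<in> {{s * a ^ k} |s k. s \<notin> M}" for F
      using that no by auto
    show "{{s * a ^ k} |s k. s \<notin> M} \<noteq> {}"
      using prime_ideal_one_notin[OF prime] by blast
    show "{f * g |f g. f \<in> F \<and> g \<in> G} \<in> {{s * a ^ k} |s k. s \<notin> M}"
      if FG: "F \<in> {{s * a ^ k} |s k. s \<notin> M}" "G \<in> {{s * a ^ k} |s k. s \<notin> M}" for F G
    proof -
      obtain s k t l where "F = {s * a ^ k}" "s \<notin> M" "G = {t * a ^ l}" "t \<notin> M"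
        using FG by auto
      moreover from this have "{f * g |f g. f \<in> F \<and> g \<in> G} = {(s * t) * a ^ (k + l)}"
        by (auto simp: power_add mult_ac)
      ultimately show ?thesis
        using prime_ideal_mult_notin[OF prime, of s t] by blast
    qed
  next
    fix Q
    assume Q: "{x. b dvd x} \<subseteq> Q" "prime_ideal Q"
      and avoid: "\<And>F. F \<in> {{s * a ^ k} |s k. s \<notin> M} \<Longrightarrow> \<not> F \<subseteq> Q"
    have "s * a ^ k \<notin> Q" if "s \<notin> M" for s k
      using avoid[of "{s * a ^ k}"] that by blast
    \<comment> \<open>The exponent 0 gives \<open>Q \<subseteq> M\<close>, and \<open>s = 1\<close>
      with exponent 1 gives \<open>a \<notin> Q\<close>.\<close>
    from this[of _ 0] this[of 1 1] have "Q \<subseteq> M" "a \<notin> Q"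
      using prime_ideal_one_notin[OF prime] by auto
    moreover have "b \<in> Q"
      using Q by auto
    ultimately show False
      using M Q(2) a b unfolding height_one_def by blast
  qed
qed

lemma loc_dvd_or_dvd:
  assumes "\<exists>s. s \<notin> M \<and> (a dvd s * b \<or> b dvd s * a)"
  obtains s c where "s \<notin> M" "s * b = a * c" | s c where "s \<notin> M" "s * a = b * c"
  using assms unfolding dvd_def by blast

definition scale :: "'a::idom \<Rightarrow> 'a set \<Rightarrow> 'a set" where
  "scale x S = {x * m |m. m \<in> S}"

lemma ideal_scale:
  assumes "is_ideal S"
  shows "is_ideal (scale x S)"
  unfolding is_ideal_def
proof (intro conjI ballI allI impI)
  show "0 \<in> scale x S"
    unfolding scale_def using ideal_zero[OF assms] by force
next
  fix y z assume "y \<in> scale x S" "z \<in> scale x S"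
  then obtain m m' where "y = x * m" "m \<in> S" "z = x * m'" "m' \<in> S"
    unfolding scale_def by blast
  then show "y + z \<in> scale x S"
    unfolding scale_def using ideal_add[OF assms, of m m']
    by (intro CollectI exI[of _ "m + m'"]) (simp add: distrib_left)
next
  fix r y assume "y \<in> scale x S"
  then obtain m where "y = x * m" "m \<in> S"
    unfolding scale_def by blast
  then show "r * y \<in> scale x S"
    unfolding scale_def using ideal_mult_left[OF assms, of m r]
    by (intro CollectI exI[of _ "r * m"]) (simp add: mult_ac)
qed

lemma scaleI: "m \<in> S \<Longrightarrow> x * m \<in> scale x S"
  unfolding scale_def by blast

lemma scaleE:
  assumes "y \<in> scale x S"
  obtains m where "m \<in> S" "y = x * m"
  using assms unfolding scale_def by blast

text \<open>If \<open>x\<close> is not in \<open>J\<close> locally, the valuation property puts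
  \<open>J\<close> inside xM. When \<open>x\<close> generates \<open>I\<close> locally, JI^n then
  lies in x^(n+1)M and misses x^(n+1). Otherwise x = yc locally with \<open>y\<close> in
  \<open>I\<close> and \<open>c\<close> in \<open>M\<close>, so yI^n lies in ycI^n; cancelling
  \<open>y\<close> and iterating puts y^n into every c^k I^n.\<close>

lemma reduction_local:
  assumes ht: "height_one M"
    and val: "\<And>a b. \<exists>s. s \<notin> M \<and> (a dvd s * b \<or> b dvd s * a)"
    and J: "is_ideal J" and x: "x \<in> I"
    and red: "ideal_prod I (ideal_pow I n) \<subseteq> loc M (ideal_prod J (ideal_pow I n))"
  shows "x \<in> loc M J"
proof (rule ccontr)
  assume xJ: "x \<notin> loc M J"
  have M: "prime_ideal M"
    using ht unfolding height_one_def by blast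
  note idM = prime_ideal_ideal[OF M]
  let ?P = "ideal_pow I n"
  have x0: "x \<noteq> 0"
    using xJ ideal_zero[OF ideal_loc[OF M J]] by blast
  \<comment> \<open>A quotient j/x that is a unit at \<open>M\<close>, or an element
    \<open>x\<close> divisible by \<open>j\<close>, would bring \<open>x\<close> into
    \<open>J\<close> locally.\<close>
  have JM: "j \<in> loc M (scale x M)" if j: "j \<in> J" for j
    using val[of x j]
  proof (cases rule: loc_dvd_or_dvd)
    case (1 s c)
    have "c * x \<in> J"
      using ideal_mult_left[OF J j, of s] 1(2) by (simp add: mult.commute)
    then have "c \<in> M"
      using xJ locI by blast
    then show ?thesis
      using 1 scaleI[of c M x] by (intro locI[of s]) auto
  next
    case (2 s c)
    have "s * x \<in> J"
      using ideal_mult_right[OF J j, of c] 2(2) by simp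
    then show ?thesis
      using xJ 2(1) locI by blast
  qed
  show False
  proof (cases "I \<subseteq> loc M {z. x dvd z}")
    case True
    have pow: "ideal_pow I k \<subseteq> loc M {z. x ^ k dvd z}" for k
    proof (induction k)
      case 0
      then show ?case
        using loc_superset[OF M, of UNIV] by auto
    next
      case (Suc k)
      show ?case
        unfolding ideal_pow.simps
      proof (intro ideal_prod_least ideal_loc[OF M] ideal_multiples)
        fix y z assume "y \<in> I" "z \<in> ideal_pow I k"
        then have "y \<in> loc M {z. x dvd z}" "z \<in> loc M {z. x ^ k dvd z}"
          using True Suc.IH by blast+
        then show "y * z \<in> loc M {z. x ^ Suc k dvd z}"
          by (rule loc_mult[OF M]) (simp add: mult_dvd_mono)
      qed
    qed
    have "ideal_prod J ?P \<subseteq> loc M (scale (x ^ Suc n) M)"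
    proof (intro ideal_prod_least ideal_loc[OF M] ideal_scale idM)
      fix j z assume "j \<in> J" "z \<in> ?P"
      then have "j \<in> loc M (scale x M)" "z \<in> loc M {z. x ^ n dvd z}"
        using JM pow by blast+
      then show "j * z \<in> loc M (scale (x ^ Suc n) M)"
      proof (rule loc_mult[OF M])
        fix u v assume "u \<in> scale x M" "v \<in> {z. x ^ n dvd z}"
        then obtain m r where "m \<in> M" "u = x * m" "v = x ^ n * r"
          by (auto elim!: scaleE dvdE)
        then show "u * v \<in> scale (x ^ Suc n) M"
          using scaleI[OF ideal_mult_right[OF idM, of m r], of "x ^ Suc n"] by (simp add: mult_ac)
      qed
    qed
    then have "ideal_prod I ?P \<subseteq> loc M (scale (x ^ Suc n) M)"
      using red loc_mono loc_idem[OF M] by blast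
    moreover have "x * x ^ n \<in> ideal_prod I ?P"
      using x by (intro ideal_prodI power_in_ideal_pow)
    \<comment> \<open>Cancelling x^(n+1) identifies an element outside \<open>M\<close> with one
      inside \<open>M\<close>.\<close>
    ultimately have "x ^ Suc n \<in> loc M (scale (x ^ Suc n) M)"
      by auto
    then obtain s m where "s \<notin> M" "m \<in> M" "s * x ^ Suc n = x ^ Suc n * m"
      by (elim locE scaleE)
    moreover from this(3) have "s = m"
      using x0 by (simp add: mult.commute)
    ultimately show False
      by blast
  next
    case False
    then obtain y where y: "y \<in> I" "y \<notin> loc M {z. x dvd z}"
      by blast
    then have y0: "y \<noteq> 0"
      using ideal_zero[OF ideal_loc[OF M ideal_multiples]] by blast
    obtain s c where s: "s \<notin> M" "s * x = y * c"
      using val[of y x]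
    proof (cases rule: loc_dvd_or_dvd)
      case (2 s c)
      then have "y \<in> loc M {z. x dvd z}"
        by (intro locI[of s]) auto
      then show ?thesis
        using y by blast
    qed
    have c: "c \<in> M"
    proof (rule ccontr)
      assume "c \<notin> M"
      then have "y \<in> loc M {z. x dvd z}"
        using s by (intro locI[of c]) (auto simp: mult.commute intro: dvdI[of _ _ s])
      then show False
        using y by blast
    qed
    have c0: "c \<noteq> 0"
      using s x0 ideal_zero[OF idM] by auto
    \<comment> \<open>Locally \<open>J\<close> lies in xM = ycM, and the factor from
      \<open>M\<close> is absorbed by I^n.\<close>
    have "ideal_prod J ?P \<subseteq> loc M (scale (y * c) ?P)"
    proof (intro ideal_prod_least ideal_loc[OF M] ideal_scale ideal_ideal_pow)
      fix j z assume j: "j \<in> J" and z: "z \<in> ?P"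
      obtain t m where t: "t \<notin> M" "m \<in> M" "t * j = x * m"
        using JM[OF j] by (elim locE scaleE)
      have "(s * t) * (j * z) = s * (t * j) * z"
        by (simp add: mult_ac)
      also have "\<dots> = s * x * (m * z)"
        using t by (simp add: mult_ac)
      also have "\<dots> = y * c * (m * z)"
        using s by simp
      also have "\<dots> \<in> scale (y * c) ?P"
        by (intro scaleI ideal_mult_left[OF ideal_ideal_pow z])
      finally show "j * z \<in> loc M (scale (y * c) ?P)"
        by (rule locI[OF prime_ideal_mult_notin[OF M s(1) t(1)]])
    qed
    then have IP: "ideal_prod I ?P \<subseteq> loc M (scale (y * c) ?P)"
      using red loc_mono loc_idem[OF M] by blast
    have step: "z \<in> loc M (scale c ?P)" if z: "z \<in> ?P" for z
    proof -
      have "y * z \<in> loc M (scale (y * c) ?P)"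
        using IP ideal_prodI[OF y(1) z] by blast
      then obtain u z' where u: "u \<notin> M" "z' \<in> ?P" "u * (y * z) = y * c * z'"
        by (elim locE scaleE)
      then have "y * (u * z) = y * (c * z')"
        by (simp add: mult_ac)
      then have "u * z = c * z'"
        using y0 by simp
      then show ?thesis
        using u scaleI[of z' ?P c] by (intro locI[of u]) simp_all
    qed
    have iter: "z \<in> loc M (scale (c ^ k) ?P)" if z: "z \<in> ?P" for k z
    proof (induction k)
      case 0
      then show ?case
        using loc_superset[OF M] scaleI[OF z, of 1] by auto
    next
      case (Suc k)
      then obtain t z' where t: "t \<notin> M" "z' \<in> ?P" "t * z = c ^ k * z'"
        by (elim locE scaleE)
      obtain u z'' where u: "u \<notin> M" "z'' \<in> ?P" "u * z' = c * z''"
        using step[OF t(2)] by (elim locE scaleE)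
      have "(u * t) * z = c ^ k * (u * z')"
        using t(3) by (simp add: mult_ac)
      also have "\<dots> = c ^ Suc k * z''"
        using u(3) by (simp add: mult_ac)
      finally show ?case
        using prime_ideal_mult_notin[OF M u(1) t(1)] scaleI[OF u(2)]
        by (intro locI[of "u * t"]) simp_all
    qed
    \<comment> \<open>The archimedean property is applied to y^n c instead of y^n: after cancelling
      y^n the remaining factor \<open>c\<close> puts the product \<open>t * u\<close> into
      \<open>M\<close>.\<close>
    have "y ^ n * c \<noteq> 0"
      using y0 c0 by simp
    from height_one_archimedean[OF ht c this]
    obtain t k r where t: "t \<notin> M" "t * c ^ k = y ^ n * c * r"
      by (auto elim: dvdE)
    obtain u z where u: "u \<notin> M" "u * y ^ n = c ^ k * z"
      using iter[OF power_in_ideal_pow[OF y(1)], of k] by (elim locE scaleE)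
    have "y ^ n * (t * u) = t * (u * y ^ n)"
      by (simp add: mult_ac)
    also have "\<dots> = t * c ^ k * z"
      using u(2) by (simp add: mult_ac)
    also have "\<dots> = y ^ n * (c * (r * z))"
      using t(2) by (simp add: mult_ac)
    finally have "t * u = c * (r * z)"
      using y0 by simp
    then show False
      using prime_ideal_mult_notin[OF M t(1) u(1)] ideal_mult_right[OF idM c, of "r * z"] by simp
  qed
qed

text \<open>Equality of w-closures yields the inclusion required by \<open>reduction_local\<close>
  at every maximal t-ideal, and membership in the w-closure of \<open>J\<close> is checked at each
  of them.\<close>

lemma w_basic_if_valuation_height_one:
  assumes ht: "\<And>M :: 'a::idom set. maximal_t_ideal M \<Longrightarrow> height_one M"
    and val: "\<And>M (a :: 'a) b. maximal_t_ideal M \<Longrightarrow> \<exists>s. s \<notin> M \<and> (a dvd s * b \<or> b dvd s * a)"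
    and I: "is_ideal (I :: 'a set)"
  shows "w_basic I"
  unfolding w_basic_def
proof (intro allI impI)
  fix J assume "w_reduction J I"
  then obtain n where J: "is_ideal J" "J \<subseteq> I"
    and eq: "wcl (ideal_prod J (ideal_pow I n)) = wcl (ideal_prod I (ideal_pow I n))"
    unfolding w_reduction_def by (auto simp: w_op_fI_eq_iff ideal_ideal_prod)
  have "I \<subseteq> wcl J"
  proof
    fix x assume x: "x \<in> I"
    show "x \<in> wcl J"
      unfolding wcl_iff_loc[OF J(1)]
    proof (intro allI impI)
      fix M :: "'a set" assume M: "maximal_t_ideal M"
      have "ideal_prod I (ideal_pow I n) \<subseteq> loc M (ideal_prod J (ideal_pow I n))"
        using M eq wcl_superset[OF ideal_ideal_prod, of I "ideal_pow I n"]
          wcl_iff_loc[OF ideal_ideal_prod] by blast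
      then show "x \<in> loc M J"
        using reduction_local[OF ht[OF M] val[OF M] J(1) x] by blast
    qed
  qed
  then have "wcl J = wcl I"
    using wcl_least[OF I J(1)] wcl_mono[OF J(2)] by blast
  then show "w_op (fI J) = w_op (fI I)"
    using I J(1) by (simp add: w_op_fI_eq_iff)
qed


subsection \<open>PvMDs and valuation localizations\<close>

lemma submodule_mod_prod: "submodule (mod_prod A B)"
  unfolding mod_prod_def by (rule submodule_rspan)

lemma mod_prodI: "a \<in> A \<Longrightarrow> b \<in> B \<Longrightarrow> a * b \<in> mod_prod A B"
  unfolding mod_prod_def by (rule subsetD[OF rspan_superset]) blast

lemma mod_prod_least:
  assumes "submodule N" "\<And>a b. a \<in> A \<Longrightarrow> b \<in> B \<Longrightarrow> a * b \<in> N"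
  shows "mod_prod A B \<subseteq> N"
  unfolding mod_prod_def using assms by (intro rspan_least) auto

text \<open>The product of \<open>I\<close> and its inverse lies in R, hence is the image of an
  integral ideal, to which the \<open>gv\<close> criterion applies.\<close>

lemma t_op_mod_prod_finv_eq_Rf_iff:
  "t_op (mod_prod (fI I) (finv (fI I))) = Rf \<longleftrightarrow>
    (\<exists>F. gv F \<and> emb ` F \<subseteq> mod_prod (fI I) (finv (fI I)))"
proof -
  let ?N = "mod_prod (fI I) (finv (fI I))"
  have "?N \<subseteq> Rf"
    by (rule mod_prod_least[OF submodule_Rf]) (auto simp: finv_def colon_def mult.commute)
  then have N: "?N = fI {r. emb r \<in> ?N}"
    unfolding fI_def Rf_def by blast
  have "t_op (fI {r. emb r \<in> ?N}) = Rf \<longleftrightarrow> (\<exists>F. gv F \<and> F \<subseteq> {r. emb r \<in> ?N})"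
    by (rule t_op_fI_eq_Rf_iff[OF ideal_emb_vimage[OF submodule_mod_prod]])
  then show ?thesis
    unfolding N[symmetric] by blast
qed

lemma finv_fI_gen: "k \<in> finv (fI (gen G)) \<longleftrightarrow> (\<forall>g\<in>G. k * emb g \<in> Rf)"
  unfolding finv_def fI_gen colon_rspan[OF submodule_Rf] by simp

text \<open>If neither of \<open>a\<close>, \<open>b\<close> divides the other at \<open>M\<close>,
  then I = (a, b) times its inverse falls into \<open>M\<close>, which contains no \<open>gv\<close>
  set.\<close>

lemma PvMD_imp_valuation:
  fixes M :: "'a::idom set"
  assumes P: "PvMD TYPE('a)" and M: "maximal_t_ideal M"
  shows "\<exists>s. s \<notin> M \<and> (a dvd s * b \<or> b dvd s * a)"
proof (rule ccontr)
  assume no: "\<nexists>s. s \<notin> M \<and> (a dvd s * b \<or> b dvd s * a)"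
  have "1 \<notin> M"
    by (rule prime_ideal_one_notin[OF maximal_t_ideal_prime[OF M]])
  then have a0: "a \<noteq> 0"
    using no by auto
  let ?I = "gen {a, b}"
  have "a \<in> ?I"
    using gen_superset by blast
  then have "?I \<noteq> {0}"
    using a0 by blast
  moreover have "fin_gen (fI ?I)"
    unfolding fin_gen_def fI_gen by (intro exI[of _ "emb ` {a, b}"]) simp
  ultimately have "t_op (mod_prod (fI ?I) (finv (fI ?I))) = Rf"
    using P ideal_gen[of "{a, b}"] unfolding PvMD_def by simp
  then obtain F where F: "gv F" "emb ` F \<subseteq> mod_prod (fI ?I) (finv (fI ?I))"
    unfolding t_op_mod_prod_finv_eq_Rf_iff by blast
  have idM: "is_ideal M"
    by (rule maximal_t_ideal_ideal[OF M])
  have "mod_prod (fI ?I) (finv (fI ?I)) \<subseteq> emb ` M"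
  proof (rule mod_prod_least[OF submodule_emb_image[OF idM]])
    fix i k assume i: "i \<in> fI ?I" and k: "k \<in> finv (fI ?I)"
    obtain p q where pq: "k * emb a = emb p" "k * emb b = emb q"
      using k unfolding finv_fI_gen Rf_def by auto
    \<comment> \<open>Both sides are kab. So \<open>p\<close> or \<open>q\<close> outside
      \<open>M\<close> would be the multiplier \<open>s\<close> that was assumed not to
      exist.\<close>
    have "emb (p * b) = emb (a * q)" "emb (q * a) = emb (b * p)"
      unfolding emb_simps pq[symmetric] by (simp_all add: mult_ac)
    then have "a dvd p * b" "b dvd q * a"
      unfolding emb_eq_iff by simp_all
    then have "p \<in> M" "q \<in> M"
      using no by blast+
    then have "emb ` {a, b} \<subseteq> {y. k * y \<in> emb ` M}"
      by (simp add: pq)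
    then have "fI ?I \<subseteq> {y. k * y \<in> emb ` M}"
      unfolding fI_gen
      by (rule rspan_least[OF _ submodule_scaled[OF submodule_emb_image[OF idM]]])
    then show "i * k \<in> emb ` M"
      using i by (auto simp: mult.commute)
  qed
  with F(2) have "emb ` F \<subseteq> emb ` M"
    by (rule subset_trans)
  then have "F \<subseteq> M"
    by auto
  then show False
    using maximal_t_ideal_no_gv[OF M F(1)] by blast
qed

text \<open>Over a valuation ring a finite set contains a generator of the ideal it spans; the
  induction collects the multipliers into one \<open>s\<close>.\<close>

lemma ex_loc_dvd_all:
  assumes M: "prime_ideal M" and val: "\<And>a b. \<exists>s. s \<notin> M \<and> (a dvd s * b \<or> b dvd s * a)"
  shows "finite G \<Longrightarrow> G \<noteq> {} \<Longrightarrow> \<exists>g\<^sub>0\<in>G. \<exists>s. s \<notin> M \<and> (\<forall>g\<in>G. g\<^sub>0 dvd s * g)"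
proof (induction G rule: finite_ne_induct)
  case (singleton x)
  then show ?case
    using prime_ideal_one_notin[OF M] by auto
next
  case (insert h G)
  then obtain g0 s where g0: "g0 \<in> G" "s \<notin> M" "\<forall>g\<in>G. g0 dvd s * g"
    by blast
  obtain t where t: "t \<notin> M" "g0 dvd t * h \<or> h dvd t * g0"
    using val[of g0 h] by blast
  have ts: "t * s \<notin> M"
    by (rule prime_ideal_mult_notin[OF M t(1) g0(2)])
  from t(2) show ?case
  proof
    assume "g0 dvd t * h"
    then have "g0 dvd s * (t * h)"
      by (rule dvd_mult)
    moreover have "g0 dvd t * (s * g)" if "g \<in> G" for g
      by (rule dvd_mult) (use g0(3) that in blast)
    ultimately have "\<forall>g\<in>insert h G. g0 dvd (t * s) * g"
      by (simp add: mult_ac)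
    then show ?thesis
      using g0(1) ts by blast
  next
    assume h: "h dvd t * g0"
    have "h dvd (t * s) * g" if "g \<in> G" for g
    proof -
      have "t * g0 dvd t * (s * g)"
        using g0(3) that by (intro mult_dvd_mono) auto
      then show ?thesis
        using dvd_trans[OF h] by (simp add: mult_ac)
    qed
    then have "\<forall>g\<in>insert h G. h dvd (t * s) * g"
      by auto
    then show ?thesis
      using ts by blast
  qed
qed

text \<open>Otherwise I times its inverse lies in a maximal t-ideal \<open>M\<close>. Locally one
  generator \<open>g\<close> divides all of \<open>G\<close>, with a common multiplier
  \<open>s\<close>; then s/g is in the inverse, and g(s/g) = s is an element of the product outside
  \<open>M\<close>.\<close>

lemma PvMD_if_valuation:
  assumes val: "\<And>M (a :: 'a::idom) b. maximal_t_ideal M \<Longrightarrow> \<exists>s. s \<notin> M \<and> (a dvd s * b \<or> b dvd s * a)"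
  shows "PvMD TYPE('a)"
  unfolding PvMD_def t_op_mod_prod_finv_eq_Rf_iff
proof (intro allI impI; elim conjE)
  fix I :: "'a set"
  assume I: "is_ideal I" "I \<noteq> {0}" "fin_gen (fI I)"
  let ?N = "mod_prod (fI I) (finv (fI I))"
  obtain F where F: "finite F" "fI I = rspan F"
    using I(3) unfolding fin_gen_def by blast
  then have "rspan F \<subseteq> fI I"
    by simp
  from rspan_subset_fI[OF F(1) this] obtain G where G: "finite G" "F = emb ` G" .
  have eq: "fI I = fI (gen G)"
    unfolding fI_gen using F(2) G(2) by simp
  then have "I = gen G"
    unfolding fI_def by (simp add: inj_image_eq_iff inj_on_def)
  have nz: "\<not> G \<subseteq> {0}"
  proof
    assume "G \<subseteq> {0}"
    then have "I \<subseteq> {0}"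
      unfolding \<open>I = gen G\<close> by (rule gen_least) (simp add: is_ideal_def)
    then show False
      using I(2) ideal_zero[OF I(1)] by blast
  qed
  show "\<exists>F. gv F \<and> emb ` F \<subseteq> ?N"
  proof (rule ccontr)
    assume "\<nexists>F. gv F \<and> emb ` F \<subseteq> ?N"
    then have "\<not> F \<subseteq> {r. emb r \<in> ?N}" if "gv F" for F
      using that by blast
    then obtain M where M: "{r. emb r \<in> ?N} \<subseteq> M" "maximal_t_ideal M" "prime_ideal M"
      using ex_maximal_t_ideal[OF ideal_emb_vimage[OF submodule_mod_prod]] by blast
    obtain g s where g: "g \<in> G" "s \<notin> M" "\<forall>h\<in>G. g dvd s * h"
      using ex_loc_dvd_all[OF M(3) val[OF M(2)] G(1)] nz by blast
    have "g \<noteq> 0"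
    proof
      assume "g = 0"
      then have "s * h = 0" if "h \<in> G" for h
        using g(3) that by auto
      then have "G \<subseteq> {0}"
        using g(2) ideal_zero[OF maximal_t_ideal_ideal[OF M(2)]] by auto
      then show False
        using nz by blast
    qed
    then have "Fract s g \<in> finv (fI I)"
      unfolding eq finv_fI_gen using g(3) by (simp add: Fract_mult_emb_in_Rf)
    moreover have "emb g \<in> fI I"
      unfolding fI_def \<open>I = gen G\<close> using g(1) gen_superset by auto
    ultimately have "emb g * Fract s g \<in> ?N"
      by (intro mod_prodI)
    moreover have "emb g * Fract s g = emb s"
      using \<open>g \<noteq> 0\<close> by (simp add: emb_def eq_fract mult_ac)
    ultimately show False
      using M(1) g(2) by auto
  qed
qed


subsection \<open>Domains all of whose ideals are w-basic\<close>

lemma ideal_two_generated: "is_ideal {u * a + v * b |u v. True}" for a b :: "'a::idom"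
  unfolding is_ideal_def
proof (intro conjI ballI allI impI)
  show "0 \<in> {u * a + v * b |u v. True}"
    by (intro CollectI exI[of _ 0]) simp
next
  fix x y assume "x \<in> {u * a + v * b |u v. True}" "y \<in> {u * a + v * b |u v. True}"
  then obtain u v u' v' where "x = u * a + v * b" "y = u' * a + v' * b"
    by blast
  then show "x + y \<in> {u * a + v * b |u v. True}"
    by (intro CollectI exI[of _ "u + u'"] exI[of _ "v + v'"]) (simp add: algebra_simps)
next
  fix r x assume "x \<in> {u * a + v * b |u v. True}"
  then obtain u v where "x = u * a + v * b"
    by blast
  then show "r * x \<in> {u * a + v * b |u v. True}"
    by (intro CollectI exI[of _ "r * u"] exI[of _ "r * v"]) (simp add: algebra_simps)
qed

text \<open>The equation makes \<open>(d)\<close> a reduction of \<open>(c, d)\<close>.\<close>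

lemma w_basic_quadratic_integral:
  assumes basic: "\<And>I :: 'a::idom set. is_ideal I \<Longrightarrow> I \<noteq> {0} \<Longrightarrow> w_basic I"
    and d: "(d :: 'a) \<noteq> 0" and eq: "c * c = d * (s * c - e * d)"
  shows "d dvd c"
proof -
  let ?I = "{u * c + v * d |u v. True}" and ?J = "{x. d dvd x}"
  have I: "is_ideal ?I"
    by (rule ideal_two_generated)
  have mem: "u * c + v * d \<in> ?I" for u v
    by blast
  have c: "c \<in> ?I" and dI: "d \<in> ?I"
    using mem[of 1 0] mem[of 0 1] by simp_all
  have "w_basic ?I"
    using basic[OF I] dI d by blast
  then have "wcl ?J = wcl ?I"
  proof (rule w_basic_wcl_eq[OF _ I ideal_multiples])
    show "?J \<subseteq> ?I"
      using ideal_mult_right[OF I dI] by (auto elim!: dvdE)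
    fix x y assume "x \<in> ?I" "y \<in> ?I"
    then obtain u v u' v' where xy: "x = u * c + v * d" "y = u' * c + v' * d"
      by blast
    have "x * y = u * u' * (c * c) + d * ((u * v' + v * u') * c + v * v' * d)"
      unfolding xy by (simp add: algebra_simps)
    \<comment> \<open>Substituting the quadratic equation for c^2 makes the whole product a multiple
      of \<open>d\<close> by an element of \<open>?I\<close>.\<close>
    also have "\<dots> = d * ((u * u' * s + u * v' + v * u') * c + (v * v' - u * u' * e) * d)"
      unfolding eq by (simp add: algebra_simps)
    finally have "x * y \<in> ideal_prod ?J ?I"
      using mem by (simp only:) (intro ideal_prodI, auto)
    then show "x * y \<in> wcl (ideal_prod ?J ?I)"
      using wcl_superset[OF ideal_ideal_prod] by blast
  qed
  then have "c \<in> wcl ?J"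
    using c wcl_superset[OF I] by blast
  \<comment> \<open>Principal ideals are w-closed: \<open>d\<close> divides F times c, hence
    c.\<close>
  then obtain F where F: "gv F" "\<forall>f\<in>F. d dvd f * c"
    unfolding wcl_def by blast
  show ?thesis
    using F(1) d by (rule gvD) (use F(2) in \<open>auto simp: mult.commute\<close>)
qed

text \<open>Since \<open>(a^2, b^2)\<close> is a reduction of \<open>(a, b)^2\<close>, locally \<open>s ab = \<alpha>a^2 + \<beta>b^2\<close>;
  then \<open>\<alpha>a/b\<close> and \<open>\<beta>b/a\<close> are integral and one of them is a unit at M.\<close>

lemma w_basic_imp_valuation:
  assumes basic: "\<And>I :: 'a::idom set. is_ideal I \<Longrightarrow> I \<noteq> {0} \<Longrightarrow> w_basic I"
    and M: "maximal_t_ideal (M :: 'a set)"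
  shows "\<exists>s. s \<notin> M \<and> (a dvd s * b \<or> b dvd s * a)"
proof (cases "a = 0 \<or> b = 0")
  case True
  then have "a dvd 1 * b \<or> b dvd 1 * a"
    by auto
  then show ?thesis
    using prime_ideal_one_notin[OF maximal_t_ideal_prime[OF M]] by blast
next
  case False
  let ?J = "{u * (a * a) + v * (b * b) |u v. True}"
  \<comment> \<open>This is (a, b)^2, written as (a^2, b^2) + (ab).\<close>
  let ?I = "adjoin ?J (a * b)"
  have J: "is_ideal ?J"
    by (rule ideal_two_generated)
  note I = adjoin(1)[OF J, of "a * b"] and JI = adjoin(2)[OF J, of "a * b"]
    and ab = adjoin(3)[OF J, of "a * b"]
  have "a * b \<noteq> 0"
    using False by simp
  then have "w_basic ?I"
    using basic[OF I] ab by blast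
  then have "wcl ?J = wcl ?I"
  proof (rule w_basic_wcl_eq[OF _ I J JI])
    fix x y assume "x \<in> ?I" and y: "y \<in> ?I"
    then obtain j r where j: "j \<in> ?J" "x = j + r * (a * b)"
      unfolding adjoin_def by blast
    obtain j' r' where j': "j' \<in> ?J" "y = j' + r' * (a * b)"
      using y unfolding adjoin_def by blast
    have mem: "u * (a * a) + v * (b * b) \<in> ?J" for u v
      by blast
    have aa: "a * a \<in> ?J" and bb: "b * b \<in> ?I"
      using mem[of 1 0] mem[of 0 1] JI by auto
    \<comment> \<open>The one product not visibly in JI, the square of ab, is regrouped as a^2 times
      b^2.\<close>
    have "x * y = j * y + r * (j' * (a * b)) + (r * r') * ((a * a) * (b * b))"
      unfolding j(2) j'(2) by (simp add: algebra_simps)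
    then have "x * y \<in> ideal_prod ?J ?I"
      using j(1) j'(1) y ab aa bb
      by (simp only:) (intro ideal_add[OF ideal_ideal_prod] ideal_mult_left[OF ideal_ideal_prod] ideal_prodI)
    then show "x * y \<in> wcl (ideal_prod ?J ?I)"
      using wcl_superset[OF ideal_ideal_prod] by blast
  qed
  then have "a * b \<in> wcl ?J"
    using ab wcl_superset[OF I] by blast
  then have "a * b \<in> loc M ?J"
    using M wcl_iff_loc[OF J] by blast
  then obtain s \<alpha> \<beta> where s: "s \<notin> M" "s * (a * b) = \<alpha> * (a * a) + \<beta> * (b * b)"
    by (elim locE) blast
  \<comment> \<open>With c = \<alpha>a and d = b this becomes the quadratic equation with
    coefficients \<open>s\<close> and \<open>\<alpha> * \<beta>\<close>.\<close>
  have "\<alpha> * a * (\<alpha> * a) = \<alpha> * (\<alpha> * (a * a))"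
    by (simp add: mult_ac)
  also have "\<alpha> * (a * a) = s * (a * b) - \<beta> * (b * b)"
    using s(2) by simp
  finally have "b dvd \<alpha> * a"
    using False by (intro w_basic_quadratic_integral[OF basic, of b "\<alpha> * a" s "\<alpha> * \<beta>"])
      (simp_all add: algebra_simps)
  then obtain p where p: "\<alpha> * a = b * p"
    by (elim dvdE)
  have "\<beta> * b * (\<beta> * b) = \<beta> * (\<beta> * (b * b))"
    by (simp add: mult_ac)
  also have "\<beta> * (b * b) = s * (a * b) - \<alpha> * (a * a)"
    using s(2) by simp
  finally have "a dvd \<beta> * b"
    using False by (intro w_basic_quadratic_integral[OF basic, of a "\<beta> * b" s "\<alpha> * \<beta>"])
      (simp_all add: algebra_simps)
  then obtain q where q: "\<beta> * b = a * q"
    by (elim dvdE)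
  \<comment> \<open>Here \<open>p\<close> is \<alpha>a/b and \<open>q\<close> is \<beta>b/a; they
    sum to \<open>s\<close>, so not both lie in \<open>M\<close>.\<close>
  have "s * (a * b) = \<alpha> * a * a + \<beta> * b * b"
    using s(2) by (simp add: mult.assoc)
  also have "\<dots> = (p + q) * (a * b)"
    unfolding p q by (simp add: algebra_simps)
  finally have "s = p + q"
    using False by simp
  then have "p \<notin> M \<or> q \<notin> M"
    using s(1) ideal_add[OF maximal_t_ideal_ideal[OF M]] by blast
  moreover have "a dvd p * b" "b dvd q * a"
    using p q by (metis dvd_triv_right mult.commute)+
  ultimately show ?thesis
    by blast
qed

text \<open>For a prime \<open>P\<close> strictly below \<open>M\<close> and \<open>b \<in> P\<close>, the contraction \<open>J\<close> of \<open>bR\<^sub>M\<close> is a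
  w-reduction of the contraction \<open>I\<close> of \<open>bR\<^sub>P\<close>, because \<open>J I\<close> and \<open>I^2\<close> agree at every
  maximal t-ideal.\<close>

lemma w_basic_imp_height_one:
  assumes basic: "\<And>I :: 'a::idom set. is_ideal I \<Longrightarrow> I \<noteq> {0} \<Longrightarrow> w_basic I"
    and M: "maximal_t_ideal (M :: 'a set)"
  shows "height_one M"
proof -
  have val: "\<exists>s. s \<notin> N \<and> (a dvd s * b \<or> b dvd s * a)" if "maximal_t_ideal N" for N and a b :: 'a
    using w_basic_imp_valuation[OF basic that] by blast
  have prM: "prime_ideal M"
    by (rule maximal_t_ideal_prime[OF M])
  have False if prP: "prime_ideal P" and PM: "P \<subseteq> M" "P \<noteq> {0}" "P \<noteq> M" for P
  proof -
    note idP = prime_ideal_ideal[OF prP]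
    obtain a where a: "a \<in> M" "a \<notin> P"
      using PM by blast
    obtain b where b: "b \<in> P" "b \<noteq> 0"
      using PM ideal_zero[OF idP] by blast
    let ?I = "loc P {x. b dvd x}" and ?J = "loc M {x. b dvd x}"
    have I: "is_ideal ?I" and J: "is_ideal ?J"
      using ideal_loc prP prM ideal_multiples by blast+
    have "b \<in> ?I"
      using loc_superset[OF prP, of "{x. b dvd x}"] by auto
    then have "w_basic ?I"
      using basic[OF I] b(2) by blast
    then have eq: "wcl ?J = wcl ?I"
    proof (rule w_basic_wcl_eq[OF _ I J])
      show "?J \<subseteq> ?I"
        by (rule loc_antimono[OF PM(1)])
      fix x y assume x: "x \<in> ?I" and y: "y \<in> ?I"
      obtain s r where s: "s \<notin> P" "s * x = b * r"
        using x by (auto elim!: locE dvdE)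
      obtain s' r' where s': "s' \<notin> P" "s' * y = b * r'"
        using y by (auto elim!: locE dvdE)
      show "x * y \<in> wcl (ideal_prod ?J ?I)"
        unfolding wcl_iff_loc[OF ideal_ideal_prod]
      proof (intro allI impI)
        fix N :: "'a set" assume N: "maximal_t_ideal N"
        note prN = maximal_t_ideal_prime[OF N]
        show "x * y \<in> loc N (ideal_prod ?J ?I)"
          using val[OF M, of b x]
        proof (cases rule: loc_dvd_or_dvd)
          case (1 u c)
          then have "x \<in> ?J"
            by (intro locI[of u]) auto
          then show ?thesis
            using ideal_prodI[OF _ y] loc_superset[OF prN] by blast
        next
          case (2 u t)
          \<comment> \<open>Here b/x equals t/u. As \<open>x\<close> lies in bR_P, this quotient
            must be a unit at \<open>P\<close>, that is, \<open>t \<notin> P\<close>.\<close>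
          have "b * (u * s) = s * (u * b)"
            by (simp add: mult_ac)
          also have "\<dots> = b * (r * t)"
            unfolding 2(2) using s(2) by (simp add: mult_ac)
          finally have "u * s = r * t"
            using b(2) by simp
          moreover have "u * s \<notin> P"
            using 2(1) PM(1) s(1) prime_ideal_mult_notin[OF prP] by blast
          ultimately have t: "t \<notin> P"
            using ideal_mult_left[OF idP, of t r] by auto
          have "b dvd x * t"
            using 2(2) by (metis dvd_triv_right)
          then have xt: "x * t \<in> ?J"
            using loc_superset[OF prM] by blast
          \<comment> \<open>The aim is to regroup xy as (xt)(y/t), whose first factor is in
            \<open>?J\<close>; this requires \<open>t\<close> to divide \<open>y\<close> at
            \<open>N\<close>.\<close>
          show ?thesis
            using val[OF N, of t y]
          proof (cases rule: loc_dvd_or_dvd)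
            case v: (1 v z)
            have "(s' * t) * z = v * (s' * y)"
              using v(2) by (simp add: mult_ac)
            then have "b dvd (s' * t) * z"
              unfolding s'(2) by simp
            then have "z \<in> ?I"
              using prime_ideal_mult_notin[OF prP s'(1) t] by (intro locI[of "s' * t"]) auto
            then have "(x * t) * z \<in> ideal_prod ?J ?I"
              by (rule ideal_prodI[OF xt])
            also have "(x * t) * z = x * (v * y)"
              by (simp only: v(2) mult.assoc)
            also have "\<dots> = v * (x * y)"
              by (rule mult.left_commute)
            finally show ?thesis
              by (rule locI[OF v(1)])
          next
            case v: (2 v e)
            \<comment> \<open>If instead \<open>y\<close> divides \<open>t\<close> at
              \<open>N\<close>, the multiplier \<open>v\<close> is forced into \<open>P\<close>.
              Although it is a unit at \<open>N\<close>, it then carries \<open>x\<close> from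
              \<open>?I\<close> into \<open>?J\<close>.\<close>
            have "s' * y \<in> P"
              unfolding s'(2) using b(1) by (rule ideal_mult_right[OF idP])
            then have "y \<in> P"
              using s'(1) prime_ideal_mult_notin[OF prP] by blast
            then have "v * t \<in> P"
              unfolding v(2) by (rule ideal_mult_right[OF idP])
            then have vP: "v \<in> P"
              using t prime_ideal_mult_notin[OF prP] by blast
            have "v * x \<in> ?J"
              using val[OF M, of b "v * x"]
            proof (cases rule: loc_dvd_or_dvd)
              case (1 q d)
              then show ?thesis
                by (intro locI[of q]) auto
            next
              case (2 q d)
              have "b * (q * s) = s * (q * b)"
                by (simp add: mult_ac)
              also have "\<dots> = b * (v * (d * r))"
                unfolding 2(2) using s(2) by (simp add: mult_ac)
              finally have "q * s = v * (d * r)"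
                using b(2) by simp
              then have "q * s \<in> P"
                using ideal_mult_right[OF idP vP] by simp
              then show ?thesis
                using 2(1) PM(1) s(1) prime_ideal_mult_notin[OF prP] by blast
            qed
            then have "(v * x) * y \<in> ideal_prod ?J ?I"
              using y by (rule ideal_prodI)
            then show ?thesis
              using v(1) by (intro locI[of v]) (simp_all add: mult.assoc)
          qed
        qed
      qed
    qed
    \<comment> \<open>The quotient b/a, taken at \<open>M\<close>, lies in \<open>?I\<close> because
      \<open>a \<notin> P\<close>, but not in \<open>?J\<close> because \<open>a \<in> M\<close>;
      this contradicts the equality of w-closures.\<close>
    show False
      using val[OF M, of a b]
    proof (cases rule: loc_dvd_or_dvd)
      case (1 s x)
      have "b dvd a * x"
        using 1(2) by (metis dvd_triv_right)
      then have "x \<in> ?I"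
        using a(2) by (intro locI[of a]) auto
      then have "x \<in> loc M ?J"
        using eq wcl_superset[OF I] wcl_iff_loc[OF J] M by blast
      then have "x \<in> ?J"
        using loc_idem[OF prM] by blast
      then obtain t d where t: "t \<notin> M" "t * x = b * d"
        by (auto elim!: locE dvdE)
      have "b * (t * s) = t * (s * b)"
        by (simp add: mult_ac)
      also have "\<dots> = b * (a * d)"
        unfolding 1(2) using t(2) by (simp add: mult_ac)
      finally have "t * s = a * d"
        using b(2) by simp
      then show ?thesis
        using prime_ideal_mult_notin[OF prM t(1) 1(1)]
          ideal_mult_right[OF prime_ideal_ideal[OF prM] a(1)] by simp
    next
      case (2 s c)
      then have "s * a \<in> P"
        using ideal_mult_right[OF idP b(1)] by simp
      then show ?thesis
        using prime_ideal_mult_notin[OF prP] 2(1) PM(1) a(2) by blast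
    qed
  qed
  then show ?thesis
    using M prM unfolding height_one_def maximal_t_ideal_def proper_t_ideal_def by blast
qed

theorem theorem2p4:
  shows "(\<forall>I::'a::idom set. is_ideal I \<and> I \<noteq> {0} \<longrightarrow> w_basic I)
         \<longleftrightarrow> (PvMD TYPE('a) \<and> t_dim_one TYPE('a))"
proof
  assume "\<forall>I::'a set. is_ideal I \<and> I \<noteq> {0} \<longrightarrow> w_basic I"
  then have basic: "\<And>I :: 'a set. is_ideal I \<Longrightarrow> I \<noteq> {0} \<Longrightarrow> w_basic I"
    by blast
  have "PvMD TYPE('a)"
    by (rule PvMD_if_valuation) (rule w_basic_imp_valuation[OF basic])
  moreover have "t_dim_one TYPE('a)"
    unfolding t_dim_one_def using w_basic_imp_height_one[OF basic] by blast
  ultimately show "PvMD TYPE('a) \<and> t_dim_one TYPE('a)" ..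
next
  assume R: "PvMD TYPE('a) \<and> t_dim_one TYPE('a)"
  show "\<forall>I::'a set. is_ideal I \<and> I \<noteq> {0} \<longrightarrow> w_basic I"
  proof (intro allI impI, elim conjE)
    fix I :: "'a set" assume "is_ideal I"
    then show "w_basic I"
    proof (rule w_basic_if_valuation_height_one[rotated 2])
      show "height_one M" if "maximal_t_ideal M" for M :: "'a set"
        using R that unfolding t_dim_one_def by blast
      show "\<exists>s. s \<notin> M \<and> (a dvd s * b \<or> b dvd s * a)" if "maximal_t_ideal M" for M and a b :: 'a
        using PvMD_imp_valuation[OF _ that] R by blast
    qed
  qed
qed

end
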